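(* Let $X,Y,Z$ be locally convex Hausdorff topological vector spaces. If $F\colon X\rightrightarrows Y$ and $G\colon Y\rightrightarrows Z$ are polyhedral convex multifunctions, then $G\circ F\colon X\rightrightarrows Z$ is a polyhedral convex multifunction.
   Context: All vector spaces are real. A subset $D$ of a locally convex Hausdorff topological vector space $E$ is a polyhedral convex set if there exist finitely many continuous linear functionals $e_i^*\in E^*$ and $\alpha_i\in\mathbb{R}$, $i=1,\dots,m$, with $D=\{e\in E\mid \langle e_i^*,e\rangle\le\alpha_i,\ i=1,\dots,m\}$. The empty set counts as polyhedral convex. A multifunction $F\colon X\rightrightarrows Y$ assigns to each $x\in X$ a (possibly empty) subset $F(x)\subset Y$; $\mathrm{gph}\,F=\{(x,y)\in X\times Y\mid y\in F(x)\}$. $F$ is polyhedral convex if $\mathrm{gph}\,F$ is a polyhedral convex set in $X\times Y$. The composition is $(G\circ F)(x)=\bigcup_{y\in F(x)}G(y)$. *)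

theory Defs
  imports "HOL-Analysis.Analysis"
begin

class topological_real_vector = real_vector + topological_ab_group_add +
  assumes tendsto_scaleR_nhds:
    "LIM p (nhds r \<times>\<^sub>F nhds x). fst p *\<^sub>R snd p :> nhds (r *\<^sub>R x)"

(* Requiring a base at the origin is enough, since translations are homeomorphisms. The convexity
   of C is written out because the constant "convex" cannot occur in a class axiom; see
   open_imp_convex_nhd_0 below. *)
class locally_convex_space = topological_real_vector +
  assumes open_imp_convex_nhd_0_raw:
    "open U \<Longrightarrow> 0 \<in> U \<Longrightarrow>
      \<exists>C. (\<forall>x\<in>C. \<forall>y\<in>C. \<forall>u\<ge>0. \<forall>v\<ge>0. u + v = 1 \<longrightarrow> u *\<^sub>R x + v *\<^sub>R y \<in> C) \<and>
        open C \<and> 0 \<in> C \<and> C \<subseteq> U"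

lemma open_imp_convex_nhd_0:
  fixes U :: "'a::locally_convex_space set"
  assumes "open U" "0 \<in> U"
  shows "\<exists>C. convex C \<and> open C \<and> 0 \<in> C \<and> C \<subseteq> U"
  unfolding convex_def using assms by (rule open_imp_convex_nhd_0_raw)

class locally_convex_hausdorff = locally_convex_space + t2_space

instance real_normed_vector \<subseteq> topological_real_vector
proof
  fix r :: real and x :: 'a
  show "LIM p (nhds r \<times>\<^sub>F nhds x). fst p *\<^sub>R snd p :> nhds (r *\<^sub>R x)"
    by (intro tendsto_scaleR filterlim_fst filterlim_snd)
qed

instance real_normed_vector \<subseteq> locally_convex_hausdorff
proof
  fix U :: "'a set"
  assume "open U" "0 \<in> U"
  then obtain e where "e > 0" "ball 0 e \<subseteq> U"
    by (auto simp: open_contains_ball)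
  then have "\<exists>C. convex C \<and> open C \<and> 0 \<in> C \<and> C \<subseteq> U"
    by (intro exI[of _ "ball 0 e"]) auto
  then show "\<exists>C. (\<forall>x\<in>C. \<forall>y\<in>C. \<forall>u\<ge>0. \<forall>v\<ge>0. u + v = 1 \<longrightarrow> u *\<^sub>R x + v *\<^sub>R y \<in> C) \<and>
      open C \<and> 0 \<in> C \<and> C \<subseteq> U"
    by (simp only: convex_def)
qed

(* The library makes products topological groups only for normed spaces, so the instances are
   established class by class, from the most general one downwards. *)
instance prod :: (topological_monoid_add, topological_monoid_add) topological_monoid_add
proof
  fix a b :: "'a \<times> 'b"
  have f: "((\<lambda>p. fst p) \<longlongrightarrow> a) (nhds a \<times>\<^sub>F nhds b)" "((\<lambda>p. snd p) \<longlongrightarrow> b) (nhds a \<times>\<^sub>F nhds b)"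
    by (rule filterlim_fst filterlim_snd)+
  have "((\<lambda>p. (fst (fst p) + fst (snd p), snd (fst p) + snd (snd p))) \<longlongrightarrow>
      (fst a + fst b, snd a + snd b)) (nhds a \<times>\<^sub>F nhds b)"
    by (intro tendsto_Pair tendsto_add tendsto_fst tendsto_snd f)
  then show "LIM p (nhds a \<times>\<^sub>F nhds b). fst p + snd p :> nhds (a + b)"
    by (simp add: plus_prod_def)
qed

instance prod :: (topological_comm_monoid_add, topological_comm_monoid_add) topological_comm_monoid_add ..

instance prod :: (topological_group_add, topological_group_add) topological_group_add
proof
  fix a :: "'a \<times> 'b"
  have "((\<lambda>p. (- fst p, - snd p)) \<longlongrightarrow> (- fst a, - snd a)) (nhds a)"
    by (intro tendsto_Pair tendsto_minus tendsto_fst tendsto_snd filterlim_ident)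
  then show "(uminus \<longlongrightarrow> - a) (nhds a)"
    by (simp add: uminus_prod_def[abs_def] fun_eq_iff)
qed

instance prod :: (topological_ab_group_add, topological_ab_group_add) topological_ab_group_add ..

instance prod :: (topological_real_vector, topological_real_vector) topological_real_vector
proof
  fix r :: real and x :: "'a \<times> 'b"
  have s: "((\<lambda>p. f p *\<^sub>R g p) \<longlongrightarrow> c *\<^sub>R y) F"
    if "(f \<longlongrightarrow> c) F" "(g \<longlongrightarrow> y) F"
    for f :: "real \<times> 'a \<times> 'b \<Rightarrow> real" and g and y :: "'c :: topological_real_vector" and c F
    using filterlim_compose[OF tendsto_scaleR_nhds, of "\<lambda>x. (f x, g x)" c y F] that
    by (simp add: nhds_prod[symmetric] tendsto_Pair)
  have f: "((\<lambda>p. fst p) \<longlongrightarrow> r) (nhds r \<times>\<^sub>F nhds x)" "((\<lambda>p. snd p) \<longlongrightarrow> x) (nhds r \<times>\<^sub>F nhds x)"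
    by (rule filterlim_fst filterlim_snd)+
  have "((\<lambda>p. (fst p *\<^sub>R fst (snd p), fst p *\<^sub>R snd (snd p))) \<longlongrightarrow>
      (r *\<^sub>R fst x, r *\<^sub>R snd x)) (nhds r \<times>\<^sub>F nhds x)"
    by (intro tendsto_Pair s tendsto_fst tendsto_snd f)
  then show "LIM p (nhds r \<times>\<^sub>F nhds x). fst p *\<^sub>R snd p :> nhds (r *\<^sub>R x)"
    by (simp add: scaleR_prod_def)
qed

instance prod :: (locally_convex_space, locally_convex_space) locally_convex_space
proof
  fix U :: "('a \<times> 'b) set"
  assume "open U" "0 \<in> U"
  then obtain A B where "open A" "open B" "0 \<in> A \<times> B" and sub: "A \<times> B \<subseteq> U"
    by (rule open_prod_elim)
  then have "0 \<in> A" "0 \<in> B"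
    by (simp_all add: zero_prod_def)
  with \<open>open A\<close> \<open>open B\<close> obtain C D where "convex C" "open C" "0 \<in> C" "C \<subseteq> A"
      and "convex D" "open D" "0 \<in> D" "D \<subseteq> B"
    by (meson open_imp_convex_nhd_0)
  with sub have "\<exists>C. convex C \<and> open C \<and> 0 \<in> C \<and> C \<subseteq> U"
    by (intro exI[of _ "C \<times> D"]) (auto simp: convex_Times open_Times zero_prod_def)
  then show "\<exists>C. (\<forall>x\<in>C. \<forall>y\<in>C. \<forall>u\<ge>0. \<forall>v\<ge>0. u + v = 1 \<longrightarrow> u *\<^sub>R x + v *\<^sub>R y \<in> C) \<and>
      open C \<and> 0 \<in> C \<and> C \<subseteq> U"
    by (simp only: convex_def)
qed

instance prod :: (locally_convex_hausdorff, locally_convex_hausdorff) locally_convex_hausdorff ..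

definition polyhedral_convex :: "'a::locally_convex_hausdorff set \<Rightarrow> bool" where
  "polyhedral_convex D \<longleftrightarrow>
    (\<exists>(m::nat) (e :: nat \<Rightarrow> 'a \<Rightarrow> real) (\<alpha> :: nat \<Rightarrow> real).
      (\<forall>i\<in>{1..m}. linear (e i) \<and> continuous_on UNIV (e i)) \<and>
      D = {x. \<forall>i\<in>{1..m}. e i x \<le> \<alpha> i})"

(* The convention on the empty set needs no separate clause: use the inequality 0 <= -1. *)
lemma polyhedral_convex_empty: "polyhedral_convex {}"
  unfolding polyhedral_convex_def
  by (intro exI[of _ 1] exI[of _ "\<lambda>_ _. 0"] exI[of _ "\<lambda>_. -1"]) (auto simp: linear_iff)

definition gph :: "('x \<Rightarrow> 'y set) \<Rightarrow> ('x \<times> 'y) set" where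
  "gph F = {(x, y). y \<in> F x}"

definition polyhedral_convex_multifunction ::
    "('x::locally_convex_hausdorff \<Rightarrow> 'y::locally_convex_hausdorff set) \<Rightarrow> bool" where
  "polyhedral_convex_multifunction F \<longleftrightarrow> polyhedral_convex (gph F)"

definition multifunction_comp :: "('y \<Rightarrow> 'z set) \<Rightarrow> ('x \<Rightarrow> 'y set) \<Rightarrow> 'x \<Rightarrow> 'z set"
    (infixl "\<circ>\<^sub>m\<^sub>f" 55) where
  "(G \<circ>\<^sub>m\<^sub>f F) x = (\<Union>y\<in>F x. G y)"

end

theory Submission
  imports Defs
begin

text \<open>
  The graph of the composition is the projection of
  \<open>Q = {((x, z), y). (x, y) \<in> gph F \<and> (y, z) \<in> gph G}\<close> along \<open>Y\<close>, and \<open>Q\<close> is polyhedral convex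
  because it is cut out by the inequalities of both graphs. So everything rests on the fact that
  projections preserve polyhedrality, although the space projected away may have infinite
  dimension. A projection is governed by the sum of \<open>Q\<close> and the subspace \<open>{0} \<times> Y\<close>; that such
  a sum is polyhedral for every subspace \<open>L\<close>, closed or not (\<open>polyhedral_convex_plus_subspace\<close>),
  combines two observations.

  The first (\<open>finite_span_realizes_functionals\<close>) removes the infinite dimension: the finitely many
  functionals that define \<open>Q\<close> induce a linear map from \<open>L\<close> to a finite-dimensional space, so its
  values are already attained on the span of finitely many vectors of \<open>L\<close>. The second
  (\<open>polyhedral_convex_plus_line\<close>) is Fourier-Motzkin elimination, which adds one line at a time; it
  replaces the inequalities by nonnegative combinations of them, so the functionals remain
  continuous.
\<close>

section \<open>Polyhedral convex sets\<close>

text \<open>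
  With the inequalities collected in a finite set of pairs instead of an enumerated list, systems
  can be united, split by sign and combined pairwise without index arithmetic.
\<close>
lemma polyhedral_convexI:
  fixes C :: "(('a::locally_convex_hausdorff \<Rightarrow> real) \<times> real) set"
  assumes "finite C"
    and cl: "\<And>e \<alpha>. (e, \<alpha>) \<in> C \<Longrightarrow> linear e \<and> continuous_on UNIV e"
    and D: "D = {x. \<forall>(e, \<alpha>)\<in>C. e x \<le> \<alpha>}"
  shows "polyhedral_convex D"
proof -
  obtain h where h: "bij_betw h {1..card C} C"
    using ex_bij_betw_nat_finite_1[OF \<open>finite C\<close>] by blast
  then have im: "C = h ` {1..card C}"
    by (simp add: bij_betw_imp_surj_on)
  have "linear (fst (h i)) \<and> continuous_on UNIV (fst (h i))" if "i \<in> {1..card C}" for i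
    by (rule cl[of _ "snd (h i)"]) (use im that in auto)
  moreover have "D = {x. \<forall>i\<in>{1..card C}. fst (h i) x \<le> snd (h i)}"
    unfolding D by (subst im) (simp add: case_prod_beta)
  ultimately show ?thesis
    unfolding polyhedral_convex_def
    by (intro exI[of _ "card C"] exI[of _ "\<lambda>i. fst (h i)"] exI[of _ "\<lambda>i. snd (h i)"]) blast
qed

lemma polyhedral_convexE:
  fixes D :: "'a::locally_convex_hausdorff set"
  assumes "polyhedral_convex D"
  obtains C :: "(('a \<Rightarrow> real) \<times> real) set" where "finite C"
    and "\<And>e \<alpha>. (e, \<alpha>) \<in> C \<Longrightarrow> linear e" "\<And>e \<alpha>. (e, \<alpha>) \<in> C \<Longrightarrow> continuous_on UNIV e"
    and "D = {x. \<forall>(e, \<alpha>)\<in>C. e x \<le> \<alpha>}"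
proof -
  from assms obtain m :: nat and e :: "nat \<Rightarrow> 'a \<Rightarrow> real" and \<alpha> where
    cl: "\<forall>i\<in>{1..m}. linear (e i) \<and> continuous_on UNIV (e i)"
    and D: "D = {x. \<forall>i\<in>{1..m}. e i x \<le> \<alpha> i}"
    unfolding polyhedral_convex_def by blast
  show thesis
    by (rule that[of "(\<lambda>i. (e i, \<alpha> i)) ` {1..m}"]) (use cl D in auto)
qed

lemma polyhedral_convex_Int:
  fixes A B :: "'a::locally_convex_hausdorff set"
  assumes "polyhedral_convex A" "polyhedral_convex B"
  shows "polyhedral_convex (A \<inter> B)"
proof -
  from assms(1) obtain C :: "(('a \<Rightarrow> real) \<times> real) set" where C: "finite C"
    "\<And>e \<alpha>. (e, \<alpha>) \<in> C \<Longrightarrow> linear e" "\<And>e \<alpha>. (e, \<alpha>) \<in> C \<Longrightarrow> continuous_on UNIV e"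
    "A = {x. \<forall>(e, \<alpha>)\<in>C. e x \<le> \<alpha>}"
    by (rule polyhedral_convexE) blast
  from assms(2) obtain C' :: "(('a \<Rightarrow> real) \<times> real) set" where C': "finite C'"
    "\<And>e \<alpha>. (e, \<alpha>) \<in> C' \<Longrightarrow> linear e" "\<And>e \<alpha>. (e, \<alpha>) \<in> C' \<Longrightarrow> continuous_on UNIV e"
    "B = {x. \<forall>(e, \<alpha>)\<in>C'. e x \<le> \<alpha>}"
    by (rule polyhedral_convexE) blast
  show ?thesis
    by (rule polyhedral_convexI[of "C \<union> C'"]) (use C C' in \<open>auto simp: ball_Un\<close>)
qed

lemma polyhedral_convex_linear_vimage:
  fixes h :: "'a::locally_convex_hausdorff \<Rightarrow> 'b::locally_convex_hausdorff"
  assumes "polyhedral_convex D" and h: "linear h" "continuous_on UNIV h"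
  shows "polyhedral_convex (h -` D)"
proof -
  from assms(1) obtain C :: "(('b \<Rightarrow> real) \<times> real) set" where C: "finite C"
    "\<And>e \<alpha>. (e, \<alpha>) \<in> C \<Longrightarrow> linear e" "\<And>e \<alpha>. (e, \<alpha>) \<in> C \<Longrightarrow> continuous_on UNIV e"
    "D = {x. \<forall>(e, \<alpha>)\<in>C. e x \<le> \<alpha>}"
    by (rule polyhedral_convexE) blast
  have "continuous_on UNIV (e \<circ> h)" if "(e, \<alpha>) \<in> C" for e \<alpha>
    using continuous_on_subset[OF C(3)[OF that]] by (intro continuous_on_compose h) auto
  then show ?thesis
    using C
    by (intro polyhedral_convexI[of "(\<lambda>(e, \<alpha>). (e \<circ> h, \<alpha>)) ` C"])
      (auto intro: linear_compose[OF h(1)])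
qed

section \<open>Adding a subspace to a polyhedral convex set\<close>

lemma finite_sets_separated_real:
  fixes L U :: "real set"
  assumes "finite L" "finite U" and le: "\<And>l u. l \<in> L \<Longrightarrow> u \<in> U \<Longrightarrow> l \<le> u"
  obtains t where "\<And>l. l \<in> L \<Longrightarrow> l \<le> t" "\<And>u. u \<in> U \<Longrightarrow> t \<le> u"
proof (cases "L = {}")
  case True
  \<comment> \<open>The extra element 0 serves only to make the minimum meaningful if \<open>U\<close> is empty as well.\<close>
  show thesis
    by (rule that[of "Min (insert 0 U)"]) (use True \<open>finite U\<close> in auto)
next
  case False
  show thesis
    by (rule that[of "Max L"]) (use False \<open>finite L\<close> le in auto)
qed

text \<open>
  Fourier-Motzkin elimination of the coordinate along \<open>v\<close>: an inequality \<open>e x + t * e v \<le> \<alpha>\<close>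
  bounds \<open>t\<close> from above if \<open>e v > 0\<close>, from below if \<open>e v < 0\<close>, and does not involve \<open>t\<close> if
  \<open>e v = 0\<close>. A suitable \<open>t\<close> exists exactly when each lower bound is at most each upper bound, and
  each of these comparisons is again an affine inequality in \<open>x\<close>.
\<close>
lemma polyhedral_convex_plus_line:
  fixes D :: "'a::locally_convex_hausdorff set"
  assumes "polyhedral_convex D"
  shows "polyhedral_convex {x. \<exists>t. x + t *\<^sub>R v \<in> D}"
proof -
  from assms obtain C :: "(('a \<Rightarrow> real) \<times> real) set" where C: "finite C"
    and lin: "\<And>e \<alpha>. (e, \<alpha>) \<in> C \<Longrightarrow> linear e"
    and cont: "\<And>e \<alpha>. (e, \<alpha>) \<in> C \<Longrightarrow> continuous_on UNIV e"
    and D: "D = {x. \<forall>(e, \<alpha>)\<in>C. e x \<le> \<alpha>}"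
    by (rule polyhedral_convexE) blast
  define Z where "Z = {c \<in> C. fst c v = 0}"
  define P where "P = {c \<in> C. fst c v > 0}"
  define N where "N = {c \<in> C. fst c v < 0}"
  define comb where "comb = (\<lambda>((e :: 'a \<Rightarrow> real, \<alpha>), (f :: 'a \<Rightarrow> real, \<beta>)).
    (\<lambda>x. (1 / e v) * e x - (1 / f v) * f x, \<alpha> / e v - \<beta> / f v))"
  have fin: "finite Z" "finite P" "finite N"
    using C by (auto simp: Z_def P_def N_def)
  have split: "C = Z \<union> P \<union> N"
    by (auto simp: Z_def P_def N_def)
  have memD: "x + t *\<^sub>R v \<in> D \<longleftrightarrow> (\<forall>(e, \<alpha>)\<in>Z. e x \<le> \<alpha>) \<and>
      (\<forall>(e, \<alpha>)\<in>P. t \<le> (\<alpha> - e x) / e v) \<and> (\<forall>(e, \<alpha>)\<in>N. (\<alpha> - e x) / e v \<le> t)" for x t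
  proof -
    have "e (x + t *\<^sub>R v) = e x + t * e v" if "(e, \<alpha>) \<in> C" for e \<alpha>
      using lin[OF that] by (simp add: linear_add linear_scale)
    then have "x + t *\<^sub>R v \<in> D \<longleftrightarrow> (\<forall>(e, \<alpha>)\<in>C. e x + t * e v \<le> \<alpha>)"
      unfolding D by auto
    also have "\<dots> \<longleftrightarrow> (\<forall>(e, \<alpha>)\<in>Z. e x + t * e v \<le> \<alpha>) \<and>
        (\<forall>(e, \<alpha>)\<in>P. e x + t * e v \<le> \<alpha>) \<and> (\<forall>(e, \<alpha>)\<in>N. e x + t * e v \<le> \<alpha>)"
      by (subst split) blast
    also have "(\<forall>(e, \<alpha>)\<in>Z. e x + t * e v \<le> \<alpha>) \<longleftrightarrow> (\<forall>(e, \<alpha>)\<in>Z. e x \<le> \<alpha>)"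
      by (rule ball_cong) (auto simp: Z_def)
    also have "(\<forall>(e, \<alpha>)\<in>P. e x + t * e v \<le> \<alpha>) \<longleftrightarrow> (\<forall>(e, \<alpha>)\<in>P. t \<le> (\<alpha> - e x) / e v)"
      by (rule ball_cong) (auto simp: P_def field_simps)
    also have "(\<forall>(e, \<alpha>)\<in>N. e x + t * e v \<le> \<alpha>) \<longleftrightarrow> (\<forall>(e, \<alpha>)\<in>N. (\<alpha> - e x) / e v \<le> t)"
      by (rule ball_cong) (auto simp: N_def field_simps)
    finally show ?thesis .
  qed
  have ex_t: "(\<exists>t. x + t *\<^sub>R v \<in> D) \<longleftrightarrow> (\<forall>(e, \<alpha>)\<in>Z. e x \<le> \<alpha>) \<and>
      (\<forall>(e, \<alpha>)\<in>P. \<forall>(f, \<beta>)\<in>N. (\<beta> - f x) / f v \<le> (\<alpha> - e x) / e v)" for x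
  proof
    assume "\<exists>t. x + t *\<^sub>R v \<in> D"
    then show "(\<forall>(e, \<alpha>)\<in>Z. e x \<le> \<alpha>) \<and>
        (\<forall>(e, \<alpha>)\<in>P. \<forall>(f, \<beta>)\<in>N. (\<beta> - f x) / f v \<le> (\<alpha> - e x) / e v)"
      unfolding memD by fastforce
  next
    assume R: "(\<forall>(e, \<alpha>)\<in>Z. e x \<le> \<alpha>) \<and>
        (\<forall>(e, \<alpha>)\<in>P. \<forall>(f, \<beta>)\<in>N. (\<beta> - f x) / f v \<le> (\<alpha> - e x) / e v)"
    let ?b = "\<lambda>(e, \<alpha>). (\<alpha> - e x) / e v"
    obtain t where "\<And>l. l \<in> ?b ` N \<Longrightarrow> l \<le> t" "\<And>u. u \<in> ?b ` P \<Longrightarrow> t \<le> u"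
      by (rule finite_sets_separated_real[of "?b ` N" "?b ` P"]) (use fin R in force)+
    with R have "x + t *\<^sub>R v \<in> D"
      unfolding memD by fastforce
    then show "\<exists>t. x + t *\<^sub>R v \<in> D" ..
  qed
  have comb_iff: "(\<beta> - f x) / f v \<le> (\<alpha> - e x) / e v \<longleftrightarrow>
      (1 / e v) * e x - (1 / f v) * f x \<le> \<alpha> / e v - \<beta> / f v" for e f :: "'a \<Rightarrow> real" and \<alpha> \<beta> x
    by (auto simp: diff_divide_distrib)
  show ?thesis
  proof (rule polyhedral_convexI[of "Z \<union> comb ` (P \<times> N)"])
    show "finite (Z \<union> comb ` (P \<times> N))"
      using fin by simp
  next
    fix g \<gamma>
    assume "(g, \<gamma>) \<in> Z \<union> comb ` (P \<times> N)"
    then consider "(g, \<gamma>) \<in> C" | e \<alpha> f \<beta> where "(e, \<alpha>) \<in> C" "(f, \<beta>) \<in> C"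
      "g = (\<lambda>x. (1 / e v) * e x - (1 / f v) * f x)"
      by (auto simp: Z_def P_def N_def comb_def)
    then show "linear g \<and> continuous_on UNIV g"
    proof cases
      case 1
      then show ?thesis using lin cont by blast
    next
      case 2
      have "linear (\<lambda>x. c * e x - d * f x)" for c d
        using lin[OF 2(1)] lin[OF 2(2)] by (auto simp: linear_iff algebra_simps)
      moreover have "continuous_on UNIV (\<lambda>x. c * e x - d * f x)" for c d
        by (intro continuous_intros cont[OF 2(1)] cont[OF 2(2)])
      ultimately show ?thesis
        unfolding 2(3) by blast
    qed
  next
    show "{x. \<exists>t. x + t *\<^sub>R v \<in> D} = {x. \<forall>(e, \<alpha>)\<in>Z \<union> comb ` (P \<times> N). e x \<le> \<alpha>}"
      unfolding ex_t comb_iff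
      by (simp add: comb_def case_prod_beta ball_Un split_paired_Ball_Sigma)
  qed
qed

lemma polyhedral_convex_plus_finite_span:
  fixes D :: "'a::locally_convex_hausdorff set"
  assumes "finite S" "polyhedral_convex D"
  shows "polyhedral_convex {x. \<exists>s\<in>span S. x + s \<in> D}"
  using assms
proof (induction S rule: finite_induct)
  case empty
  then show ?case by simp
next
  case (insert v S)
  have "{x. \<exists>s\<in>span (insert v S). x + s \<in> D} =
      {x. \<exists>t. x + t *\<^sub>R v \<in> {x. \<exists>s\<in>span S. x + s \<in> D}}"
  proof (intro set_eqI iffI)
    fix x
    assume "x \<in> {x. \<exists>s\<in>span (insert v S). x + s \<in> D}"
    then obtain s t where "x + s \<in> D" "s - t *\<^sub>R v \<in> span S"
      by (auto simp: span_insert)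
    then show "x \<in> {x. \<exists>t. x + t *\<^sub>R v \<in> {x. \<exists>s\<in>span S. x + s \<in> D}}"
      by (auto intro!: exI[of _ t] bexI[of _ "s - t *\<^sub>R v"])
  next
    fix x
    assume "x \<in> {x. \<exists>t. x + t *\<^sub>R v \<in> {x. \<exists>s\<in>span S. x + s \<in> D}}"
    then obtain s t where "x + t *\<^sub>R v + s \<in> D" "s \<in> span S"
      by auto
    then have "x + (t *\<^sub>R v + s) \<in> D" "(t *\<^sub>R v + s) - t *\<^sub>R v \<in> span S"
      by (simp_all add: add.assoc)
    then show "x \<in> {x. \<exists>s\<in>span (insert v S). x + s \<in> D}"
      unfolding span_insert by blast
  qed
  with insert show ?case
    by (simp only: polyhedral_convex_plus_line)
qed

text \<open>
  Finitely many functionals see only finitely many dimensions of \<open>L\<close>. Each new functional \<open>b\<close> needs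
  at most one more vector: either \<open>b\<close> vanishes wherever on \<open>L\<close> the previous functionals do, and
  then it cannot distinguish two vectors of \<open>L\<close> that they identify; or it is nonzero at some common
  zero \<open>w\<close> of theirs in \<open>L\<close>, and a multiple of \<open>w\<close> corrects its value without disturbing theirs.
\<close>
lemma finite_span_realizes_functionals:
  fixes B :: "('a::real_vector \<Rightarrow> real) set"
  assumes "finite B" "\<And>b. b \<in> B \<Longrightarrow> linear b" and L: "subspace L"
  shows "\<exists>S. finite S \<and> S \<subseteq> L \<and> (\<forall>y\<in>L. \<exists>s\<in>span S. \<forall>b\<in>B. b s = b y)"
  using assms(1,2)
proof (induction B rule: finite_induct)
  case empty
  show ?case
    by (auto intro!: exI[of _ "{}"])
next
  case (insert b B)
  then obtain S where S: "finite S" "S \<subseteq> L" "\<And>y. y \<in> L \<Longrightarrow> \<exists>s\<in>span S. \<forall>b\<in>B. b s = b y"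
    by auto
  have lin: "linear b" "\<And>c. c \<in> B \<Longrightarrow> linear c"
    using insert.prems by auto
  have span_L: "span S \<subseteq> L"
    using S(2) L by (rule span_minimal)
  show ?case
  proof (cases "\<exists>w\<in>L. (\<forall>c\<in>B. c w = 0) \<and> b w \<noteq> 0")
    case True
    then obtain w where w: "w \<in> L" "\<And>c. c \<in> B \<Longrightarrow> c w = 0" "b w \<noteq> 0"
      by blast
    have "\<exists>s\<in>span (insert w S). \<forall>c\<in>insert b B. c s = c y" if y: "y \<in> L" for y
    proof -
      obtain s where s: "s \<in> span S" "\<And>c. c \<in> B \<Longrightarrow> c s = c y"
        using S(3)[OF y] by blast
      define s' where "s' = s + ((b y - b s) / b w) *\<^sub>R w"
      have "s' \<in> span (insert w S)"
        unfolding s'_def using s(1) span_mono[OF subset_insertI[of S w]]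
        by (auto intro: span_add span_scale span_base)
      moreover have "b s' = b y"
        unfolding s'_def using lin(1) w(3) by (simp add: linear_add linear_scale)
      moreover have "c s' = c y" if "c \<in> B" for c
        unfolding s'_def using lin(2)[OF that] w(2)[OF that] s(2)[OF that]
        by (simp add: linear_add linear_scale)
      ultimately show ?thesis by blast
    qed
    with S w(1) show ?thesis
      by (intro exI[of _ "insert w S"]) auto
  next
    case False
    have "\<exists>s\<in>span S. \<forall>c\<in>insert b B. c s = c y" if y: "y \<in> L" for y
    proof -
      obtain s where s: "s \<in> span S" "\<And>c. c \<in> B \<Longrightarrow> c s = c y"
        using S(3)[OF y] by blast
      have "s - y \<in> L"
        using s(1) span_L y L by (auto intro: subspace_diff)
      moreover have "\<forall>c\<in>B. c (s - y) = 0"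
        using lin(2) s(2) by (simp add: linear_diff)
      ultimately have "b (s - y) = 0"
        using False by blast
      with s lin(1) show ?thesis
        by (auto simp: linear_diff)
    qed
    with S(1,2) show ?thesis
      by (intro exI[of _ S]) auto
  qed
qed

lemma polyhedral_convex_plus_subspace:
  fixes D :: "'a::locally_convex_hausdorff set"
  assumes D: "polyhedral_convex D" and L: "subspace L"
  shows "polyhedral_convex {x. \<exists>y\<in>L. x + y \<in> D}"
proof -
  from D obtain C :: "(('a \<Rightarrow> real) \<times> real) set" where C: "finite C"
    and lin: "\<And>e \<alpha>. (e, \<alpha>) \<in> C \<Longrightarrow> linear e"
    and D_eq: "D = {x. \<forall>(e, \<alpha>)\<in>C. e x \<le> \<alpha>}"
    by (rule polyhedral_convexE) blast
  have "finite (fst ` C)" "\<And>b. b \<in> fst ` C \<Longrightarrow> linear b"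
    using C lin by auto
  from finite_span_realizes_functionals[OF this L]
  obtain S where S: "finite S" "S \<subseteq> L"
    "\<And>y. y \<in> L \<Longrightarrow> \<exists>s\<in>span S. \<forall>b\<in>fst ` C. b s = b y"
    by blast
  have "\<exists>s\<in>span S. x + s \<in> D" if y: "y \<in> L" "x + y \<in> D" for x y
  proof -
    obtain s where s: "s \<in> span S" "\<And>b. b \<in> fst ` C \<Longrightarrow> b s = b y"
      using S(3)[OF y(1)] by blast
    have "e (x + s) \<le> \<alpha>" if c: "(e, \<alpha>) \<in> C" for e \<alpha>
    proof -
      have "e s = e y"
        using c by (intro s(2)) force
      then have "e (x + s) = e (x + y)"
        using lin[OF c] by (simp add: linear_add)
      also have "\<dots> \<le> \<alpha>"
        using y(2) c unfolding D_eq by auto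
      finally show ?thesis .
    qed
    then have "x + s \<in> D"
      unfolding D_eq by auto
    with s(1) show ?thesis by blast
  qed
  moreover have "span S \<subseteq> L"
    using S(2) L by (rule span_minimal)
  ultimately have "{x. \<exists>y\<in>L. x + y \<in> D} = {x. \<exists>s\<in>span S. x + s \<in> D}"
    by blast
  then show ?thesis
    using polyhedral_convex_plus_finite_span[OF S(1) D] by simp
qed

section \<open>Projections and compositions\<close>

text \<open>
  A point \<open>x\<close> lies in the projection exactly when \<open>(x, 0)\<close> can be moved into \<open>Q\<close> along
  \<open>{0} \<times> UNIV\<close>, so the projection is the preimage of a polyhedral set under the embedding
  \<open>x \<mapsto> (x, 0)\<close>.
\<close>
lemma polyhedral_convex_fst_image:
  fixes Q :: "('a::locally_convex_hausdorff \<times> 'b::locally_convex_hausdorff) set"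
  assumes "polyhedral_convex Q"
  shows "polyhedral_convex (fst ` Q)"
proof -
  let ?D = "{p. \<exists>q\<in>{0} \<times> UNIV. p + q \<in> Q}"
  have "subspace ({0} \<times> UNIV :: ('a \<times> 'b) set)"
    by (intro subspace_Times) simp_all
  then have "polyhedral_convex ?D"
    by (rule polyhedral_convex_plus_subspace[OF assms])
  moreover have "linear (\<lambda>x::'a. (x, 0::'b))"
    by (auto simp: linear_iff)
  moreover have "continuous_on UNIV (\<lambda>x::'a. (x, 0::'b))"
    by (intro continuous_intros)
  ultimately have "polyhedral_convex ((\<lambda>x. (x, 0)) -` ?D)"
    by (rule polyhedral_convex_linear_vimage)
  also have "(\<lambda>x. (x, 0)) -` ?D = fst ` Q"
    by force
  finally show ?thesis .
qed

theorem theorem4p2: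
  fixes F :: "'x::locally_convex_hausdorff \<Rightarrow> 'y::locally_convex_hausdorff set"
    and G :: "'y \<Rightarrow> 'z::locally_convex_hausdorff set"
  assumes "polyhedral_convex_multifunction F"
    and "polyhedral_convex_multifunction G"
  shows "polyhedral_convex_multifunction (G \<circ>\<^sub>m\<^sub>f F)"
proof -
  let ?f = "\<lambda>p :: ('x \<times> 'z) \<times> 'y. (fst (fst p), snd p)"
  let ?g = "\<lambda>p :: ('x \<times> 'z) \<times> 'y. (snd p, snd (fst p))"
  have lin: "linear ?f" "linear ?g"
    by (auto simp: linear_iff)
  have cont: "continuous_on UNIV ?f" "continuous_on UNIV ?g"
    by (intro continuous_intros)+
  have "polyhedral_convex (?f -` gph F \<inter> ?g -` gph G)"
    using assms unfolding polyhedral_convex_multifunction_def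
    by (intro polyhedral_convex_Int polyhedral_convex_linear_vimage lin cont)
  then have "polyhedral_convex (fst ` (?f -` gph F \<inter> ?g -` gph G))"
    by (rule polyhedral_convex_fst_image)
  also have "fst ` (?f -` gph F \<inter> ?g -` gph G) = gph (G \<circ>\<^sub>m\<^sub>f F)"
  proof (intro set_eqI iffI)
    fix p
    assume "p \<in> gph (G \<circ>\<^sub>m\<^sub>f F)"
    then obtain x y z where "p = (x, z)" "y \<in> F x" "z \<in> G y"
      by (auto simp: gph_def multifunction_comp_def)
    then show "p \<in> fst ` (?f -` gph F \<inter> ?g -` gph G)"
      by (intro image_eqI[of _ _ "((x, z), y)"]) (simp_all add: gph_def)
  qed (auto simp: gph_def multifunction_comp_def)
  finally show ?thesis
    unfolding polyhedral_convex_multifunction_def .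
qed

end
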